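(* Let $\alpha,\gamma\in\mathbb C$ and $z\in\mathbb C\setminus(-\infty,1]$. (a) Suppose $\alpha+\gamma\notin-\mathbb N$. If $\gamma\notin-\mathbb N$, then $$Q_\gamma^{(\alpha,\alpha)}(z)=\frac{2^\alpha e^{i\pi\alpha}\Gamma(\alpha+\gamma+1)}{\Gamma(\gamma+1)(z^2-1)^{\frac12\alpha}}\,Q_{\alpha+\gamma}^{-\alpha}(z),$$ and if $2\alpha+\gamma\notin-\mathbb N$, then $$Q_\gamma^{(\alpha,\alpha)}(z)=\frac{2^\alpha e^{-i\pi\alpha}\Gamma(\alpha+\gamma+1)}{\Gamma(2\alpha+\gamma+1)(z^2-1)^{\frac12\alpha}}\,Q_{\alpha+\gamma}^{\alpha}(z).$$ (b) Suppose $\gamma-\alpha\notin-\mathbb N$ and $\gamma+\alpha\notin-\mathbb N$. Then $$Q_\gamma^{(\alpha,-\alpha)}(z)=\frac{e^{-i\pi\alpha}\Gamma(\gamma-\alpha+1)}{\Gamma(\gamma+1)}\Bigl(\frac{z+1}{z-1}\Bigr)^{\frac12\alpha}Q_\gamma^\alpha(z),\qquad Q_\gamma^{(-\alpha,\alpha)}(z)=\frac{e^{-i\pi\alpha}\Gamma(\gamma-\alpha+1)}{\Gamma(\gamma+1)}\Bigl(\frac{z-1}{z+1}\Bigr)^{\frac12\alpha}Q_\gamma^\alpha(z).$$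
   Context: $\mathbb N=\{1,2,3,\dots\}$. ${}_2\mathbf F_1(a,b;c;z)=\sum_{k\ge0}\frac{(a)_k(b)_k}{\Gamma(c+k)}\frac{z^k}{k!}$ is the Olver normalized Gauss hypergeometric function, continued analytically to $\mathbb C\setminus[1,\infty)$. Powers are principal and $(z^2-1)^a:=(z+1)^a(z-1)^a$; $1/\Gamma$ is $0$ at nonpositive integers. Jacobi function of the second kind ($\alpha+\gamma,\beta+\gamma\notin-\mathbb N$): $Q_\gamma^{(\alpha,\beta)}(z)=\frac{2^{\alpha+\beta+\gamma}\Gamma(\alpha+\gamma+1)\Gamma(\beta+\gamma+1)}{(z-1)^{\alpha+\gamma+1}(z+1)^\beta}{}_2\mathbf F_1\bigl(\gamma+1,\alpha+\gamma+1;\alpha+\beta+2\gamma+2;\tfrac2{1-z}\bigr)$, $z\in\mathbb C\setminus[-1,1]$. Associated Legendre function of the second kind ($\nu+\mu\notin-\mathbb N$): $Q_\nu^\mu(z)=\frac{\sqrt\pi\,e^{i\pi\mu}\Gamma(\nu+\mu+1)(z^2-1)^{\frac12\mu}}{2^{\nu+1}z^{\nu+\mu+1}}{}_2\mathbf F_1\bigl(\tfrac{\nu+\mu+1}2,\tfrac{\nu+\mu+2}2;\nu+\tfrac32;\tfrac1{z^2}\bigr)$, $z\in\mathbb C\setminus(-\infty,1]$ (by analytic continuation). *)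

theory Defs
  imports "HOL-Complex_Analysis.Complex_Analysis"
begin

text \<open>
  The set \<open>{-1, -2, -3, \<dots>}\<close>; zero is not included.
\<close>

definition neg_Nats :: "complex set" where
  "neg_Nats = (\<lambda>n::nat. - of_nat n) ` {1..}"

text \<open>
  Olver's normalized Gauss hypergeometric function. The series (in which \<^const>\<open>rGamma\<close> is the
  entire function \<open>1/\<Gamma>\<close>, so that no condition on \<open>c\<close> is needed) converges on the open unit disc.
  The function is its analytic continuation to the plane cut along \<open>[1, \<infinity>)\<close>. The continuation is
  unique because the cut plane is connected; on the cut itself we fix the arbitrary value 0 so that
  the description determines a total function.
\<close>

definition hyp2F1_coeff :: "complex \<Rightarrow> complex \<Rightarrow> complex \<Rightarrow> nat \<Rightarrow> complex" where
  "hyp2F1_coeff a b c k =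
     pochhammer a k * pochhammer b k * rGamma (c + of_nat k) / fact k"

definition hyp2F1 :: "complex \<Rightarrow> complex \<Rightarrow> complex \<Rightarrow> complex \<Rightarrow> complex" where
  "hyp2F1 a b c = (THE f.
      f holomorphic_on (- complex_of_real ` {1..}) \<and>
      (\<forall>z\<in>ball 0 1. (\<lambda>k. hyp2F1_coeff a b c k * z ^ k) sums f z) \<and>
      (\<forall>z\<in>complex_of_real ` {1..}. f z = 0))"

text \<open>
  The convention for \<open>(z\<^sup>2 - 1)\<^sup>a\<close>: a product of two principal powers, which is holomorphic off
  \<open>(-\<infinity>, 1]\<close> and in general differs from the principal power of \<open>z\<^sup>2 - 1\<close>.
\<close>

definition sq_minus_one_powr :: "complex \<Rightarrow> complex \<Rightarrow> complex" where
  "sq_minus_one_powr z a = (z + 1) powr a * (z - 1) powr a"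

text \<open>
  The Jacobi function of the second kind \<open>Q\<^sub>\<gamma>\<^sup>(\<^sup>\<alpha>\<^sup>,\<^sup>\<beta>\<^sup>)(z)\<close>,
  meaningful for \<open>\<alpha> + \<gamma>\<close> and \<open>\<beta> + \<gamma>\<close> outside \<^const>\<open>neg_Nats\<close> and \<open>z\<close> outside \<open>[-1, 1]\<close>.
\<close>

definition Jacobi_Q :: "complex \<Rightarrow> complex \<Rightarrow> complex \<Rightarrow> complex \<Rightarrow> complex" where
  "Jacobi_Q \<gamma> \<alpha> \<beta> z =
     2 powr (\<alpha> + \<beta> + \<gamma>) * Gamma (\<alpha> + \<gamma> + 1) * Gamma (\<beta> + \<gamma> + 1)
       / ((z - 1) powr (\<alpha> + \<gamma> + 1) * (z + 1) powr \<beta>)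
       * hyp2F1 (\<gamma> + 1) (\<alpha> + \<gamma> + 1) (\<alpha> + \<beta> + 2 * \<gamma> + 2) (2 / (1 - z))"

text \<open>
  The associated Legendre function of the second kind \<open>Q\<^sub>\<nu>\<^sup>\<mu>(z)\<close>, meaningful for \<open>\<nu> + \<mu>\<close> outside
  \<^const>\<open>neg_Nats\<close> and \<open>z\<close> outside \<open>(-\<infinity>, 1]\<close>. For such \<open>z\<close> the point \<open>1/z\<^sup>2\<close> avoids \<open>[1, \<infinity>)\<close> and
  all powers are evaluated off their cuts, so the formula is holomorphic on the whole domain, and
  hence is itself the analytic continuation from \<open>\<bar>z\<bar> > 1\<close>.
\<close>

definition Legendre_Q :: "complex \<Rightarrow> complex \<Rightarrow> complex \<Rightarrow> complex" where
  "Legendre_Q \<nu> \<mu> z =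
     of_real (sqrt pi) * exp (\<i> * of_real pi * \<mu>) * Gamma (\<nu> + \<mu> + 1)
       * sq_minus_one_powr z (\<mu> / 2)
       / (2 powr (\<nu> + 1) * z powr (\<nu> + \<mu> + 1))
       * hyp2F1 ((\<nu> + \<mu> + 1) / 2) ((\<nu> + \<mu> + 2) / 2) (\<nu> + 3 / 2) (1 / z\<^sup>2)"

end

theory Submission
  imports Defs
begin

text \<open>
  After the substitution \<open>w = 2 / (1 - z)\<close> the Jacobi function is a multiple of
  \<open>F(a, b; 2 b; w)\<close>, where \<open>F\<close> is Olver's function and
  \<open>{a, b} = {\<gamma> + 1, \<alpha> + \<gamma> + 1}\<close>; the parameter \<open>b\<close> is \<open>\<alpha> + \<gamma> + 1\<close> when the two upper
  parameters of the Jacobi function are equal, and \<open>\<gamma> + 1\<close> when they are opposite. A Legendre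
  function of degree \<open>b - 1\<close> and order \<open>a - b\<close> is a multiple of
  \<open>F(a / 2, a / 2 + 1 / 2; b + 1 / 2; 1 / z\<^sup>2)\<close>. The quadratic transformation
    \<open>F(a, b; 2 b; w) =
      2\<^bsup>1 - 2 b\<^esup> \<surd>\<pi> / \<Gamma>(b) (1 - w / 2)\<^bsup>-a\<^esup> F(a / 2, a / 2 + 1 / 2; b + 1 / 2; (w / (2 - w))\<^sup>2)\<close>
  connects them, because \<open>w / (2 - w) = -1 / z\<close>. Applied directly it produces the Legendre function of
  order \<open>-\<alpha>\<close> for equal parameters and of order \<open>\<alpha>\<close> for the pair \<open>(\<alpha>, -\<alpha>)\<close>. The other two formulas
  follow by applying it after the Pfaff transformation, which replaces \<open>a\<close> by \<open>2 b - a\<close> and \<open>w\<close> by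
  \<open>w / (w - 1) = 2 / (1 + z)\<close>. What remains is to compare powers of \<open>z\<close> and \<open>z \<plusminus> 1\<close>; their logarithms
  may be subtracted freely since these three points lie on the same side of the real axis
  or all on its positive half.

  The transformations must hold on the whole plane cut along \<open>[1, \<infinity>)\<close>, so the analytic continuation
  of the hypergeometric series has to be constructed first. For the two families that occur, quadratic
  transformations give it explicitly. The family \<open>F(a, a + 1 / 2; c; x)\<close> satisfies
    \<open>F(a, a + 1 / 2; c; 4 v / (1 + v)\<^sup>2) = (1 + v)\<^bsup>2 a\<^esup> F(2 a, 2 a - c + 1; c; v)\<close>,
  and \<open>v \<mapsto> 4 v / (1 + v)\<^sup>2\<close> maps the unit disc bijectively onto the cut plane; hence the right-hand
  side, a convergent power series in the disc, is the continuation (\<open>hyp2F1_half\<close>). The family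
  \<open>F(a, b; 2 b; w)\<close> is then continued by the transformation displayed above, because
  \<open>w \<mapsto> (w / (2 - w))\<^sup>2\<close> maps the cut plane into itself (\<open>hyp2F1_double\<close>).

  In each case a function that is holomorphic on the cut plane equals \<open>F\<close> as soon as it has the right
  Taylor coefficients at 0 (\<open>hyp2F1_eqI\<close>). This reduces the transformations to identities of formal
  power series, whose coefficients are the Chu-Vandermonde sum and one sum that is solved by a two-step
  recurrence. Both sums are proved with the entire function \<open>1 / \<Gamma>\<close>, so parameters for which
  \<open>c\<close> is a nonpositive integer need no separate limit argument.
\<close>

section \<open>Binomial series and composition\<close>

text \<open>
  The binomial series of \<open>(1 - t x)\<^bsup>-p\<^esup>\<close>. With the sign of \<open>p\<close> reversed the coefficients are rising
  factorials, which combine with those of the hypergeometric series.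
\<close>

definition fps_neg_powr :: "complex \<Rightarrow> complex \<Rightarrow> complex fps" where
  "fps_neg_powr t p = Abs_fps (\<lambda>n. pochhammer p n * t ^ n / fact n)"

lemma fps_neg_powr_0 [simp]: "fps_neg_powr t 0 = 1"
  by (auto simp: fps_neg_powr_def fps_eq_iff pochhammer_0_left)

lemma fps_neg_powr_nth_0 [simp]: "fps_nth (fps_neg_powr t p) 0 = 1"
  by (simp add: fps_neg_powr_def)

lemma fps_neg_powr_add: "fps_neg_powr t (p + q) = fps_neg_powr t p * fps_neg_powr t q"
proof (rule fps_ext)
  fix n
  have "fps_nth (fps_neg_powr t p * fps_neg_powr t q) n =
      (\<Sum>k\<le>n. pochhammer p k * t ^ k / fact k * (pochhammer q (n - k) * t ^ (n - k) / fact (n - k)))"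
    by (simp add: fps_neg_powr_def fps_mult_nth atLeast0AtMost)
  also have "\<dots> = (\<Sum>k\<le>n. of_nat (n choose k) * pochhammer p k * pochhammer q (n - k) * t ^ n / fact n)"
  proof (intro sum.cong refl)
    fix k assume "k \<in> {..n}"
    then have k: "k \<le> n" by simp
    have "t ^ n = t ^ k * t ^ (n - k)"
      using k by (simp flip: power_add)
    then show "pochhammer p k * t ^ k / fact k * (pochhammer q (n - k) * t ^ (n - k) / fact (n - k)) =
        of_nat (n choose k) * pochhammer p k * pochhammer q (n - k) * t ^ n / fact n"
      using k by (simp add: binomial_fact field_simps)
  qed
  also have "\<dots> = fps_nth (fps_neg_powr t (p + q)) n"
    by (simp add: fps_neg_powr_def pochhammer_binomial_sum sum_distrib_right sum_divide_distrib)
  finally show "fps_nth (fps_neg_powr t (p + q)) n = fps_nth (fps_neg_powr t p * fps_neg_powr t q) n"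
    by simp
qed

lemma fps_neg_powr_power: "fps_neg_powr t p ^ k = fps_neg_powr t (of_nat k * p)"
  by (induction k) (simp_all add: fps_neg_powr_add ring_distribs)

lemma has_fps_expansion_neg_powr:
  "(\<lambda>x. (1 - t * x) powr (- p)) has_fps_expansion fps_neg_powr t p"
proof -
  have "((\<lambda>x. (1 + x) powr (- p)) \<circ> (\<lambda>x. - t * x)) has_fps_expansion
          fps_compose (fps_binomial (- p)) (fps_const (- t) * fps_X)"
    by (intro has_fps_expansion_compose fps_expansion_intros) simp_all
  also have "fps_compose (fps_binomial (- p)) (fps_const (- t) * fps_X) = fps_neg_powr t p"
    by (auto simp: fps_compose_linear fps_eq_iff fps_neg_powr_def gbinomial_pochhammer
        simp flip: power_mult_distrib)
  finally show ?thesis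
    by (simp add: o_def)
qed

lemma fps_mult_compose_nth:
  fixes F G H :: "'a :: idom fps"
  assumes "fps_nth G 0 = 0"
  shows "fps_nth (F * (H oo G)) n = (\<Sum>k\<le>n. fps_nth H k * fps_nth (F * G ^ k) n)"
proof -
  have "fps_nth (F * (H oo G)) n = (\<Sum>i\<le>n. \<Sum>k\<le>n - i. fps_nth F i * (fps_nth H k * fps_nth (G ^ k) (n - i)))"
    by (simp add: fps_mult_nth fps_compose_nth sum_distrib_left atLeast0AtMost)
  also have "\<dots> = (\<Sum>i\<le>n. \<Sum>k\<le>n. fps_nth F i * (fps_nth H k * fps_nth (G ^ k) (n - i)))"
  proof (rule sum.cong[OF refl], rule sum.mono_neutral_left, goal_cases)
    case (3 i)
    show ?case
    proof
      \<comment> \<open>\<open>G ^ k\<close> starts in degree \<open>k\<close>, so the inner sum may run up to \<open>n\<close> for every \<open>i\<close>.\<close>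
      fix k assume "k \<in> {..n} - {..n - i}"
      then show "fps_nth F i * (fps_nth H k * fps_nth (G ^ k) (n - i)) = 0"
        using startsby_zero_power_prefix[OF assms] by simp
    qed
  qed auto
  also have "\<dots> = (\<Sum>k\<le>n. \<Sum>i\<le>n. fps_nth F i * (fps_nth H k * fps_nth (G ^ k) (n - i)))"
    by (rule sum.swap)
  also have "\<dots> = (\<Sum>k\<le>n. fps_nth H k * fps_nth (F * G ^ k) n)"
    by (simp add: fps_mult_nth sum_distrib_left atLeast0AtMost mult_ac)
  finally show ?thesis .
qed

text \<open>
  All three transformations below have the form of a power times a hypergeometric series in a
  monomial times a power of the same base; here the coefficients of such products become finite sums.
\<close>

lemma fps_neg_powr_mult_compose_nth:
  assumes "m > 0"
  shows "fps_nth (fps_neg_powr t p * (H oo (fps_const c * fps_X ^ m * fps_neg_powr t r))) n =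
    (\<Sum>k | m * k \<le> n. fps_nth H k * c ^ k *
       (pochhammer (p + of_nat k * r) (n - m * k) * t ^ (n - m * k) / fact (n - m * k)))"
proof -
  let ?G = "fps_const c * fps_X ^ m * fps_neg_powr t r"
  let ?u = "\<lambda>k. pochhammer (p + of_nat k * r) (n - m * k) * t ^ (n - m * k) / fact (n - m * k)"
  have "fps_neg_powr t p * ?G ^ k =
      fps_const (c ^ k) * (fps_X ^ (m * k) * fps_neg_powr t (p + of_nat k * r))" for k
    by (simp add: power_mult_distrib fps_neg_powr_power fps_neg_powr_add fps_const_power
        mult_ac flip: power_mult)
  then have nth: "fps_nth (fps_neg_powr t p * ?G ^ k) n = (if m * k \<le> n then c ^ k * ?u k else 0)" for k
    by (simp add: fps_X_power_mult_nth fps_neg_powr_def)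
  have le: "k \<le> m * k" for k
    using assms by (cases m) auto
  have "fps_nth (fps_neg_powr t p * (H oo ?G)) n =
      (\<Sum>k\<le>n. fps_nth H k * fps_nth (fps_neg_powr t p * ?G ^ k) n)"
    by (rule fps_mult_compose_nth) (use assms in simp)
  also have "\<dots> = (\<Sum>k\<in>{k\<in>{..n}. m * k \<le> n}. fps_nth H k * c ^ k * ?u k)"
    unfolding nth by (subst sum.inter_filter) (auto intro!: sum.cong)
  also have "{k\<in>{..n}. m * k \<le> n} = {k. m * k \<le> n}"
    by (auto intro: le_trans[OF le])
  finally show ?thesis .
qed

section \<open>Finite sums of reciprocal Gamma values\<close>

text \<open>
  Where \<open>\<Gamma>(c)\<close> is defined, multiplication by it turns the left-hand side into the terminating Gauss
  series \<open>F(-n, d; c; 1)\<close> in the usual normalization. Pascal's rule splits the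
  sum for \<open>n + 1\<close> into the sums for \<open>(c, d)\<close> and \<open>(c + 1, d + 1)\<close>, and \<open>x / \<Gamma>(x + 1) = 1 / \<Gamma>(x)\<close>
  joins them.
\<close>

lemma rGamma_Chu_Vandermonde:
  fixes c d :: complex
  shows "(\<Sum>k\<le>n. (-1) ^ k * of_nat (n choose k) * pochhammer d k * rGamma (c + of_nat k)) =
    pochhammer (c - d) n * rGamma (c + of_nat n)"
proof (induction n arbitrary: c d)
  case (Suc n)
  let ?f = "\<lambda>k. (-1) ^ k * pochhammer d k * rGamma (c + of_nat k)"
  have "(\<Sum>k\<le>Suc n. (-1) ^ k * of_nat (Suc n choose k) * pochhammer d k * rGamma (c + of_nat k)) =
      ?f 0 + (\<Sum>k\<le>n. of_nat (Suc n choose Suc k) * ?f (Suc k))"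
    by (subst sum.atMost_Suc_shift) (simp add: mult_ac)
  also have "\<dots> = (?f 0 + (\<Sum>k\<le>n. of_nat (n choose Suc k) * ?f (Suc k))) +
      (\<Sum>k\<le>n. of_nat (n choose k) * ?f (Suc k))"
    by (simp add: ring_distribs sum.distrib sum_subtractf sum_negf)
  also have "?f 0 + (\<Sum>k\<le>n. of_nat (n choose Suc k) * ?f (Suc k)) = (\<Sum>k\<le>Suc n. of_nat (n choose k) * ?f k)"
    by (subst sum.atMost_Suc_shift) simp
  also have "\<dots> = (\<Sum>k\<le>n. of_nat (n choose k) * ?f k)"
    by simp
  also have "\<dots> = pochhammer (c - d) n * rGamma (c + of_nat n)"
    using Suc.IH[of d c] by (simp add: mult_ac)
  also have "(\<Sum>k\<le>n. of_nat (n choose k) * ?f (Suc k)) =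
      - d * (\<Sum>k\<le>n. (-1) ^ k * of_nat (n choose k) * pochhammer (d + 1) k * rGamma (c + 1 + of_nat k))"
    by (simp add: pochhammer_rec sum_distrib_left mult_ac add_ac)
  also have "\<dots> = - d * (pochhammer (c - d) n * rGamma (c + of_nat (Suc n)))"
    using Suc.IH[of "d + 1" "c + 1"] by (simp add: add_ac)
  also have "rGamma (c + of_nat n) = (c + of_nat n) * rGamma (c + of_nat (Suc n))"
    using rGamma_plus1[of "c + of_nat n"] by (simp add: add_ac)
  finally show ?case
    by (simp add: pochhammer_Suc algebra_simps)
qed simp

text \<open>
  The exceptional points of the duplication formula for \<open>\<Gamma>\<close> disappear for \<open>1 / \<Gamma>\<close>: at each of them
  \<open>2 z\<close> is a nonpositive integer and both sides vanish.
\<close>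

lemma rGamma_legendre_duplication:
  "rGamma (2 * z :: complex) = 2 powr (1 - 2 * z) * of_real (sqrt pi) * rGamma z * rGamma (z + 1 / 2)"
proof (cases "z \<in> \<int>\<^sub>\<le>\<^sub>0 \<or> z + 1 / 2 \<in> \<int>\<^sub>\<le>\<^sub>0")
  case True
  have "2 * z \<in> \<int>\<^sub>\<le>\<^sub>0"
  proof (cases "z \<in> \<int>\<^sub>\<le>\<^sub>0")
    case True
    then obtain n where "z = - of_nat n"
      by (auto elim: nonpos_Ints_cases')
    then have "2 * z = - of_nat (2 * n)" by simp
    then show ?thesis by (metis minus_of_nat_in_nonpos_Ints)
  next
    case False
    with True obtain n where "z + 1 / 2 = - of_nat n"
      by (auto elim: nonpos_Ints_cases')
    then have "2 * z = - of_nat (2 * n + 1)"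
      by (simp add: field_simps) (metis add.commute add_diff_cancel_left' diff_conv_add_uminus minus_add_distrib)
    then show ?thesis by (metis minus_of_nat_in_nonpos_Ints)
  qed
  then have "rGamma (2 * z) = 0"
    by (simp add: rGamma_eq_zero_iff)
  moreover have "rGamma z = 0 \<or> rGamma (z + 1 / 2) = 0"
    using True by (simp add: rGamma_eq_zero_iff)
  ultimately show ?thesis
    by auto
next
  case False
  then have *: "Gamma z * Gamma (z + 1 / 2) = 2 powr (1 - 2 * z) * of_real (sqrt pi) * Gamma (2 * z)"
    using Gamma_legendre_duplication[of z] by (simp add: powr_def Ln_of_real[of 2, simplified])
  have "Gamma z * Gamma (z + 1 / 2) \<noteq> 0"
    using False by (simp add: Gamma_eq_zero_iff)
  with * show ?thesis
    by (auto simp: rGamma_inverse_Gamma field_simps)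
qed

text \<open>
  This sum collects the contributions to one coefficient of the quadratic transformation for
  \<open>c = 2 b\<close>. Up to normalization its terms are those of the Gauss series
  \<open>F(-n / 2, (1 - n) / 2; b + 1 / 2; 1)\<close>. Treating it by a recurrence in \<open>n\<close> avoids splitting into
  even and odd \<open>n\<close>: the weights \<open>w n k\<close> are, up to scaling, the coefficients of Hermite polynomials,
  and their three-term recurrence relates \<open>n + 2\<close> at \<open>b\<close> to \<open>n + 1\<close> at \<open>b\<close> and \<open>n\<close> at \<open>b + 1\<close>.
  The factor \<open>C b\<close> vanishes together with \<open>1 / \<Gamma>(b)\<close>; keeping it on the left makes the identity valid
  for all \<open>b\<close>.
\<close>

lemma rGamma_even_binomial_sum:
  fixes b :: complex
  shows "2 powr (1 - 2 * b) * of_real (sqrt pi) * rGamma b *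
      (\<Sum>k | 2 * k \<le> n. fact n / (4 ^ k * fact k * fact (n - 2 * k)) * rGamma (b + 1 / 2 + of_nat k)) =
    2 ^ n * pochhammer b n * rGamma (2 * b + of_nat n)"
proof -
  define C where "C = (\<lambda>b::complex. 2 powr (1 - 2 * b) * of_real (sqrt pi) * rGamma b)"
  define w :: "nat \<Rightarrow> nat \<Rightarrow> complex" where
    "w = (\<lambda>n k. if 2 * k \<le> n then fact n / (4 ^ k * fact k * fact (n - 2 * k)) else 0)"
  define T where "T = (\<lambda>n b. \<Sum>k\<le>n. w n k * rGamma (b + 1 / 2 + of_nat k))"
  have w_rec: "w (Suc (Suc n)) (Suc k) = w (Suc n) (Suc k) + of_nat (Suc n) / 2 * w n k" for n k
  proof (cases "2 * k \<le> n")
    case True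
    then obtain j where n: "n = 2 * k + j"
      using le_Suc_ex by blast
    have nz: "1 + of_nat i \<noteq> (0 :: complex)" for i
      by (metis of_nat_Suc of_nat_neq_0)
    have nz4: "4 + of_nat k * 4 \<noteq> (0 :: complex)"
    proof -
      have "4 + of_nat k * 4 = 4 * (1 + of_nat k :: complex)"
        by (simp add: algebra_simps)
      with nz[of k] show ?thesis
        by (simp only: mult_eq_0_iff) simp
    qed
    show ?thesis
    proof (cases j)
      case 0
      then show ?thesis
        using nz4 by (simp add: n w_def divide_simps nz) (simp add: algebra_simps)?
    next
      case (Suc i)
      then show ?thesis
        using nz4 by (simp add: n w_def divide_simps nz) (simp add: algebra_simps)?
    qed
  qed (simp add: w_def)
  have w_0: "w n 0 = 1" for n
    by (simp add: w_def)
  have T_rec: "T (Suc (Suc n)) b = T (Suc n) b + of_nat (Suc n) / 2 * T n (b + 1)" for n b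
  proof -
    let ?r = "\<lambda>k. rGamma (b + 1 / 2 + of_nat k)"
    have "T (Suc (Suc n)) b = w (Suc (Suc n)) 0 * ?r 0 + (\<Sum>k\<le>Suc n. w (Suc (Suc n)) (Suc k) * ?r (Suc k))"
      unfolding T_def by (rule sum.atMost_Suc_shift)
    also have "\<dots> = (w (Suc n) 0 * ?r 0 + (\<Sum>k\<le>Suc n. w (Suc n) (Suc k) * ?r (Suc k))) +
        of_nat (Suc n) / 2 * (\<Sum>k\<le>Suc n. w n k * ?r (Suc k))"
      unfolding w_rec by (simp add: w_0 ring_distribs sum.distrib sum_distrib_left mult_ac)
    also have "w (Suc n) 0 * ?r 0 + (\<Sum>k\<le>Suc n. w (Suc n) (Suc k) * ?r (Suc k)) =
        (\<Sum>k\<le>Suc (Suc n). w (Suc n) k * ?r k)"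
      by (rule sum.atMost_Suc_shift[symmetric])
    also have "\<dots> = T (Suc n) b"
      by (simp add: T_def w_def)
    also have "(\<Sum>k\<le>Suc n. w n k * ?r (Suc k)) = T n (b + 1)"
      by (simp add: T_def w_def add_ac)
    finally show ?thesis .
  qed
  have C_rec: "C b = 4 * b * C (b + 1)" for b
  proof -
    have "(2 :: complex) powr (1 - 2 * b) = 2 powr (2 + (1 - 2 * (b + 1)))"
      by (simp add: algebra_simps)
    also have "\<dots> = 4 * 2 powr (1 - 2 * (b + 1))"
      by (subst powr_add) simp
    finally show ?thesis
      unfolding C_def rGamma_plus1[of b, symmetric] by (simp only: mult_ac)
  qed
  have "C b * T n b = 2 ^ n * pochhammer b n * rGamma (2 * b + of_nat n)"
  proof (induction n arbitrary: b rule: induct_nat_012)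
    case 0
    show ?case
      using rGamma_legendre_duplication[of b] by (simp add: T_def w_def C_def)
  next
    case 1
    have "C b * T 1 b = rGamma (2 * b)"
      using rGamma_legendre_duplication[of b] by (simp add: T_def w_def C_def)
    then show ?case
      using rGamma_plus1[of "2 * b"] by simp
  next
    case (ge2 n)
    have "C b * T (Suc (Suc n)) b = C b * T (Suc n) b + 2 * b * of_nat (Suc n) * (C (b + 1) * T n (b + 1))"
      unfolding T_rec ring_distribs(1) by (simp add: C_rec[of b])
    also have "C b * T (Suc n) b = 2 ^ Suc n * pochhammer b (Suc n) *
        ((2 * b + of_nat (Suc n)) * rGamma (2 * b + of_nat (Suc (Suc n))))"
      using ge2(2)[of b] rGamma_plus1[of "2 * b + of_nat (Suc n)"] by (simp add: add_ac)
    also have "C (b + 1) * T n (b + 1) = 2 ^ n * pochhammer (b + 1) n * rGamma (2 * b + of_nat (Suc (Suc n)))"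
      using ge2(1)[of "b + 1"] by (simp add: algebra_simps)
    also have "2 * b * of_nat (Suc n) * (2 ^ n * pochhammer (b + 1) n * rGamma (2 * b + of_nat (Suc (Suc n)))) =
       2 ^ Suc n * pochhammer b (Suc n) * (of_nat (Suc n) * rGamma (2 * b + of_nat (Suc (Suc n))))"
      by (simp add: pochhammer_rec)
    finally show ?case
      by (simp add: pochhammer_Suc[of b "Suc n"] algebra_simps)
  qed
  also have "T n b = (\<Sum>k | 2 * k \<le> n. w n k * rGamma (b + 1 / 2 + of_nat k))"
    unfolding T_def by (rule sum.mono_neutral_right) (auto simp: w_def)
  also have "\<dots> = (\<Sum>k | 2 * k \<le> n. fact n / (4 ^ k * fact k * fact (n - 2 * k)) * rGamma (b + 1 / 2 + of_nat k))"
    by (intro sum.cong) (simp_all add: w_def)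
  finally show ?thesis
    by (simp only: C_def)
qed

section \<open>Transformations of the hypergeometric series\<close>

definition hyp2F1_fps :: "complex \<Rightarrow> complex \<Rightarrow> complex \<Rightarrow> complex fps" where
  "hyp2F1_fps a b c = Abs_fps (hyp2F1_coeff a b c)"

text \<open>
  The series form of \<open>F(a, b; c; w) = (1 - w)\<^bsup>-a\<^esup> F(a, c - b; c; w / (w - 1))\<close>. Since
  \<open>(a)\<^sub>k (a + k)\<^sub>n\<^sub>-\<^sub>k = (a)\<^sub>n\<close> leaves the sum, the coefficient is a Chu-Vandermonde sum.
\<close>

lemma hyp2F1_fps_Pfaff:
  "fps_neg_powr 1 a * (hyp2F1_fps a (c - b) c oo (fps_const (- 1) * fps_X ^ 1 * fps_neg_powr 1 1)) =
     hyp2F1_fps a b c"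
proof (rule fps_ext)
  fix n
  have "fps_nth (fps_neg_powr 1 a * (hyp2F1_fps a (c - b) c oo
           (fps_const (- 1) * fps_X ^ 1 * fps_neg_powr 1 1))) n =
      (\<Sum>k\<le>n. hyp2F1_coeff a (c - b) c k * (-1) ^ k * (pochhammer (a + of_nat k) (n - k) / fact (n - k)))"
    by (subst fps_neg_powr_mult_compose_nth) (simp_all add: hyp2F1_fps_def atMost_def)
  also have "\<dots> = (\<Sum>k\<le>n. pochhammer a n / fact n *
      ((-1) ^ k * of_nat (n choose k) * pochhammer (c - b) k * rGamma (c + of_nat k)))"
  proof (intro sum.cong refl)
    fix k assume "k \<in> {..n}"
    then have k: "k \<le> n" by simp
    show "hyp2F1_coeff a (c - b) c k * (-1) ^ k * (pochhammer (a + of_nat k) (n - k) / fact (n - k)) =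
        pochhammer a n / fact n * ((-1) ^ k * of_nat (n choose k) * pochhammer (c - b) k * rGamma (c + of_nat k))"
      using k by (simp add: hyp2F1_coeff_def binomial_fact pochhammer_product[OF k] field_simps)
  qed
  also have "\<dots> = pochhammer a n / fact n * (pochhammer b n * rGamma (c + of_nat n))"
    by (simp only: sum_distrib_left[symmetric] rGamma_Chu_Vandermonde) simp
  finally show "fps_nth (fps_neg_powr 1 a * (hyp2F1_fps a (c - b) c oo
           (fps_const (- 1) * fps_X ^ 1 * fps_neg_powr 1 1))) n = fps_nth (hyp2F1_fps a b c) n"
    by (simp add: hyp2F1_fps_def hyp2F1_coeff_def)
qed

text \<open>
  The series form of
  \<open>(1 + v)\<^bsup>-2 a\<^esup> F(a, a + 1 / 2; c; 4 v / (1 + v)\<^sup>2) = F(2 a, 2 a - c + 1; c; v)\<close>. By duplication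
  \<open>4\<^sup>k (a)\<^sub>k (a + 1 / 2)\<^sub>k = (2 a)\<^sub>2\<^sub>k\<close>, which merges with \<open>(2 a + 2 k)\<^sub>n\<^sub>-\<^sub>k\<close> to
  \<open>(2 a)\<^sub>n\<^sub>+\<^sub>k = (2 a)\<^sub>n (2 a + n)\<^sub>k\<close> and again leaves a Chu-Vandermonde sum.
\<close>

lemma hyp2F1_fps_quadratic_half:
  "fps_neg_powr (- 1) (2 * a) *
     (hyp2F1_fps a (a + 1 / 2) c oo (fps_const 4 * fps_X ^ 1 * fps_neg_powr (- 1) 2)) =
   hyp2F1_fps (2 * a) (2 * a - c + 1) c"
proof (rule fps_ext)
  fix n
  have "fps_nth (fps_neg_powr (- 1) (2 * a) *
     (hyp2F1_fps a (a + 1 / 2) c oo (fps_const 4 * fps_X ^ 1 * fps_neg_powr (- 1) 2))) n =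
      (\<Sum>k\<le>n. hyp2F1_coeff a (a + 1 / 2) c k * 4 ^ k *
        (pochhammer (2 * a + of_nat k * 2) (n - k) * (- 1) ^ (n - k) / fact (n - k)))"
    by (subst fps_neg_powr_mult_compose_nth) (simp_all add: hyp2F1_fps_def atMost_def)
  also have "\<dots> = (\<Sum>k\<le>n. (-1) ^ n * pochhammer (2 * a) n / fact n *
      ((-1) ^ k * of_nat (n choose k) * pochhammer (2 * a + of_nat n) k * rGamma (c + of_nat k)))"
  proof (intro sum.cong refl)
    fix k assume "k \<in> {..n}"
    then have k: "k \<le> n" by simp
    have "pochhammer a k * pochhammer (a + 1 / 2) k * 4 ^ k * pochhammer (2 * a + of_nat k * 2) (n - k) =
        pochhammer (2 * a) (2 * k) * pochhammer (2 * a + of_nat (2 * k)) (n - k)"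
      using pochhammer_double[of a k] by (simp add: power_mult) (simp add: mult_ac)
    also have "\<dots> = pochhammer (2 * a) (2 * k + (n - k))"
      by (rule pochhammer_product'[symmetric])
    also have "2 * k + (n - k) = n + k"
      using k by simp
    also have "pochhammer (2 * a) (n + k) = pochhammer (2 * a) n * pochhammer (2 * a + of_nat n) k"
      by (rule pochhammer_product')
    finally have *: "pochhammer a k * pochhammer (a + 1 / 2) k * 4 ^ k * pochhammer (2 * a + of_nat k * 2) (n - k) = \<dots>" .
    have "(-1) ^ (n - k) = (-1 :: complex) ^ n * (-1) ^ k"
    proof -
      obtain j where "n = k + j"
        using k le_Suc_ex by blast
      then show ?thesis
        by (simp add: power_add minus_one_power_iff)
    qed
    then have "hyp2F1_coeff a (a + 1 / 2) c k * 4 ^ k *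
        (pochhammer (2 * a + of_nat k * 2) (n - k) * (- 1) ^ (n - k) / fact (n - k)) =
       (pochhammer a k * pochhammer (a + 1 / 2) k * 4 ^ k * pochhammer (2 * a + of_nat k * 2) (n - k)) *
       ((-1) ^ n * (-1) ^ k * rGamma (c + of_nat k) / (fact k * fact (n - k)))"
      by (simp add: hyp2F1_coeff_def)
    also have "\<dots> = (-1) ^ n * pochhammer (2 * a) n / fact n *
      ((-1) ^ k * of_nat (n choose k) * pochhammer (2 * a + of_nat n) k * rGamma (c + of_nat k))"
      unfolding * using k by (simp add: binomial_fact field_simps)
    finally show "hyp2F1_coeff a (a + 1 / 2) c k * 4 ^ k *
        (pochhammer (2 * a + of_nat k * 2) (n - k) * (- 1) ^ (n - k) / fact (n - k)) = \<dots>" .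
  qed
  also have "\<dots> = (-1) ^ n * pochhammer (2 * a) n / fact n *
      (pochhammer (c - (2 * a + of_nat n)) n * rGamma (c + of_nat n))"
    by (simp only: sum_distrib_left[symmetric] rGamma_Chu_Vandermonde)
  also have "pochhammer (c - (2 * a + of_nat n)) n = (-1) ^ n * pochhammer (2 * a - c + 1) n"
    using pochhammer_minus[of "2 * a - c + of_nat n" n] by (simp add: algebra_simps)
  finally show "fps_nth (fps_neg_powr (- 1) (2 * a) *
     (hyp2F1_fps a (a + 1 / 2) c oo (fps_const 4 * fps_X ^ 1 * fps_neg_powr (- 1) 2))) n =
      fps_nth (hyp2F1_fps (2 * a) (2 * a - c + 1) c) n"
    by (simp add: hyp2F1_fps_def hyp2F1_coeff_def mult_ac flip: power_mult_distrib)
qed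

text \<open>
  The series form of the quadratic transformation for \<open>c = 2 b\<close>. The rising factorials of \<open>a\<close> combine
  to \<open>(a)\<^sub>n\<close>, so the remaining sum depends only on \<open>b\<close> and \<open>n\<close>.
\<close>

lemma hyp2F1_fps_quadratic_double:
  "fps_const (2 powr (1 - 2 * b) * of_real (sqrt pi) * rGamma b) * (fps_neg_powr (1 / 2) a *
     (hyp2F1_fps (a / 2) (a / 2 + 1 / 2) (b + 1 / 2) oo (fps_const (1 / 4) * fps_X ^ 2 * fps_neg_powr (1 / 2) 2))) =
   hyp2F1_fps a b (2 * b)"
proof (rule fps_ext)
  fix n
  let ?C = "2 powr (1 - 2 * b) * of_real (sqrt pi) * rGamma b"
  let ?F = "fps_neg_powr (1 / 2) a * (hyp2F1_fps (a / 2) (a / 2 + 1 / 2) (b + 1 / 2) oo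
    (fps_const (1 / 4) * fps_X ^ 2 * fps_neg_powr (1 / 2) 2))"
  let ?S = "\<Sum>k | 2 * k \<le> n. fact n / (4 ^ k * fact k * fact (n - 2 * k)) * rGamma (b + 1 / 2 + of_nat k)"
  have "fps_nth ?F n =
      (\<Sum>k | 2 * k \<le> n. hyp2F1_coeff (a / 2) (a / 2 + 1 / 2) (b + 1 / 2) k * (1 / 4) ^ k *
        (pochhammer (a + of_nat k * 2) (n - 2 * k) * (1 / 2) ^ (n - 2 * k) / fact (n - 2 * k)))"
    by (subst fps_neg_powr_mult_compose_nth) (simp_all add: hyp2F1_fps_def)
  also have "\<dots> = (\<Sum>k | 2 * k \<le> n. pochhammer a n / (2 ^ n * fact n) *
      (fact n / (4 ^ k * fact k * fact (n - 2 * k)) * rGamma (b + 1 / 2 + of_nat k)))"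
  proof (intro sum.cong refl)
    fix k assume "k \<in> {k. 2 * k \<le> n}"
    then obtain j where n: "n = 2 * k + j"
      using le_Suc_ex by blast
    have "pochhammer a (2 * k + j) = pochhammer a (2 * k) * pochhammer (a + of_nat (2 * k)) j"
      by (rule pochhammer_product')
    also have "pochhammer a (2 * k) = 4 ^ k * pochhammer (a / 2) k * pochhammer (a / 2 + 1 / 2) k"
      using pochhammer_double[of "a / 2" k] by (simp add: power_mult)
    moreover have "(2 ^ k)\<^sup>2 = (4 :: complex) ^ k"
      by (simp add: power2_eq_square flip: power_mult_distrib)
    ultimately show "hyp2F1_coeff (a / 2) (a / 2 + 1 / 2) (b + 1 / 2) k * (1 / 4) ^ k *
        (pochhammer (a + of_nat k * 2) (n - 2 * k) * (1 / 2) ^ (n - 2 * k) / fact (n - 2 * k)) =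
       pochhammer a n / (2 ^ n * fact n) *
      (fact n / (4 ^ k * fact k * fact (n - 2 * k)) * rGamma (b + 1 / 2 + of_nat k))"
      by (simp add: n hyp2F1_coeff_def power_add power_mult power_divide field_simps)
  qed
  also have "\<dots> = pochhammer a n / (2 ^ n * fact n) * ?S"
    by (simp only: sum_distrib_left)
  finally have F: "fps_nth ?F n = pochhammer a n / (2 ^ n * fact n) * ?S" .
  have "fps_nth (fps_const ?C * ?F) n = ?C * fps_nth ?F n"
    by (rule fps_mult_left_const_nth)
  also have "\<dots> = pochhammer a n / (2 ^ n * fact n) * (?C * ?S)"
    unfolding F by (simp only: mult_ac)
  also have "\<dots> = fps_nth (hyp2F1_fps a b (2 * b)) n"
    unfolding rGamma_even_binomial_sum by (simp add: hyp2F1_fps_def hyp2F1_coeff_def)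
  finally show "fps_nth (fps_const ?C * ?F) n = fps_nth (hyp2F1_fps a b (2 * b)) n" .
qed

section \<open>Recognizing the analytic continuation\<close>

definition cut_plane :: "complex set" where
  "cut_plane = - complex_of_real ` {1..}"

lemma closed_of_real_atLeast: "closed (complex_of_real ` {1..})"
  by (rule closed_injective_linear_image) (auto simp: inj_def linear_iff scaleR_conv_of_real)

lemma open_cut_plane: "open cut_plane"
  using closed_of_real_atLeast by (simp add: cut_plane_def open_Compl)

lemma cut_plane_iff: "z \<in> cut_plane \<longleftrightarrow> 1 - z \<notin> \<real>\<^sub>\<le>\<^sub>0"
proof -
  have "1 - z \<in> \<real>\<^sub>\<le>\<^sub>0 \<longleftrightarrow> Re z \<ge> 1 \<and> Im z = 0"
    by (auto simp: complex_nonpos_Reals_iff)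
  also have "\<dots> \<longleftrightarrow> z \<in> complex_of_real ` {1..}"
    by (auto simp: image_iff complex_eq_iff)
  finally show ?thesis
    by (simp add: cut_plane_def)
qed

lemma zero_in_cut_plane: "0 \<in> cut_plane"
  by (simp add: cut_plane_iff complex_nonpos_Reals_iff)

lemma ball_subset_cut_plane: "ball 0 1 \<subseteq> cut_plane"
proof
  fix z :: complex assume "z \<in> ball 0 1"
  then have "Re z < 1"
    using complex_Re_le_cmod[of z] by simp
  then show "z \<in> cut_plane"
    by (simp add: cut_plane_iff complex_nonpos_Reals_iff)
qed

lemma connected_cut_plane: "connected cut_plane"
proof (rule starlike_imp_connected)
  show "starlike cut_plane"
    unfolding starlike_def
  proof (intro bexI[OF _ zero_in_cut_plane] ballI subsetI)
    fix z x assume z: "z \<in> cut_plane" and "x \<in> closed_segment 0 z"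
    then obtain u where u: "0 \<le> u" "u \<le> 1" "x = of_real u * z"
      by (auto simp: closed_segment_def scaleR_conv_of_real)
    show "x \<in> cut_plane"
    proof (rule ccontr)
      assume "x \<notin> cut_plane"
      then have x: "u * Re z \<ge> 1" "u * Im z = 0"
        by (auto simp: u cut_plane_iff complex_nonpos_Reals_iff)
      then have "u > 0"
        using u by (cases "u = 0") auto
      moreover have "u * Re z \<le> Re z"
      proof -
        have "Re z \<ge> 0"
          using x \<open>u > 0\<close> by (smt (verit) mult_pos_neg)
        with u show ?thesis
          by (simp add: mult_left_le_one_le)
      qed
      ultimately have "Im z = 0" "Re z \<ge> 1"
        using x by auto
      with z show False
        by (auto simp: cut_plane_iff complex_nonpos_Reals_iff)
    qed
  qed
qed

text \<open>
  The defining description of \<^const>\<open>hyp2F1\<close> asks for convergence on the whole unit disc, but a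
  holomorphic function on the cut plane is the sum of its Taylor series there. It therefore suffices to
  know the germ at 0, and the identity theorem on the connected cut plane gives uniqueness.
\<close>

lemma hyp2F1_eqI:
  assumes hol: "f holomorphic_on cut_plane"
    and exp: "f has_fps_expansion hyp2F1_fps a b c" and z: "z \<in> cut_plane"
  shows "hyp2F1 a b c z = f z"
proof -
  define g where "g = (\<lambda>z. if z \<in> cut_plane then f z else 0)"
  have "hyp2F1 a b c = g"
    unfolding hyp2F1_def cut_plane_def[symmetric]
  proof (rule the_equality, safe)
    show "g holomorphic_on cut_plane"
      using hol by (rule holomorphic_transform) (simp add: g_def)
    fix z :: complex assume "z \<in> ball 0 1"
    moreover have "f holomorphic_on ball 0 1"
      using hol ball_subset_cut_plane by (rule holomorphic_on_subset)
    ultimately have "(\<lambda>n. (deriv ^^ n) f 0 / fact n * (z - 0) ^ n) sums f z"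
      by (intro holomorphic_power_series)
    moreover have "(deriv ^^ n) f 0 / fact n = hyp2F1_coeff a b c n" for n
      using fps_nth_fps_expansion[OF exp, of n] by (simp add: hyp2F1_fps_def)
    moreover have "z \<in> cut_plane"
      using \<open>z \<in> ball 0 1\<close> ball_subset_cut_plane by blast
    ultimately show "(\<lambda>k. hyp2F1_coeff a b c k * z ^ k) sums g z"
      by (simp add: g_def)
  next
    fix x :: real assume "1 \<le> x"
    then show "g (of_real x) = 0"
      by (auto simp: g_def cut_plane_def)
  next
    fix h :: "complex \<Rightarrow> complex"
    assume h: "h holomorphic_on cut_plane"
      "\<forall>z\<in>ball 0 1. (\<lambda>k. hyp2F1_coeff a b c k * z ^ k) sums h z"
      "\<forall>z\<in>complex_of_real ` {1..}. h z = 0"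
    have "eventually (\<lambda>z. z \<in> ball 0 (1 :: real)) (nhds (0 :: complex))"
      by (intro eventually_nhds_in_open) auto
    then have "eventually (\<lambda>z. (\<lambda>k. fps_nth (hyp2F1_fps a b c) k * z ^ k) sums h z) (nhds 0)"
      by eventually_elim (use h(2) in \<open>auto simp: hyp2F1_fps_def\<close>)
    then have "h has_fps_expansion hyp2F1_fps a b c"
      by (rule has_fps_expansionI)
    then have 0: "(\<lambda>z. h z - f z) has_fps_expansion 0"
      using exp has_fps_expansion_diff by fastforce
    have "h z = f z" if "z \<in> cut_plane" for z
      using has_fps_expansion_0_analytic_continuation[OF 0 _ open_cut_plane connected_cut_plane zero_in_cut_plane that]
        h(1) hol by (auto intro: holomorphic_intros)
    with h(3) show "h = g"
      by (auto simp: g_def cut_plane_def fun_eq_iff)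
  qed
  with z show ?thesis
    by (simp add: g_def)
qed

text \<open>
  Consecutive coefficients differ by a rational factor in \<open>k\<close> that tends to 1. The ratio test is applied
  to this factor and not to quotients of coefficients, since these may vanish, as they do eventually
  when \<open>a\<close> or \<open>b\<close> is a nonpositive integer.
\<close>

lemma hyp2F1_fps_conv_radius: "fps_conv_radius (hyp2F1_fps a b c) \<ge> 1"
proof -
  let ?a = "hyp2F1_coeff a b c"
  have rec: "?a (Suc k) * ((c + of_nat k) * of_nat (Suc k)) = ?a k * ((a + of_nat k) * (b + of_nat k))" for k
  proof -
    have *: "rGamma (c + of_nat k) = (c + of_nat k) * rGamma (c + of_nat (Suc k))"
      using rGamma_plus1[of "c + of_nat k"] by (simp add: add_ac)
    show ?thesis
      unfolding hyp2F1_coeff_def * pochhammer_Suc fact_Suc of_nat_mult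
      using of_nat_neq_0[of k, where 'a = complex] by (simp add: divide_simps del: of_nat_Suc)
  qed
  have "ereal 1 \<le> conv_radius ?a"
  proof (rule conv_radius_geI_ex')
    fix r :: real assume r: "0 < r" "ereal r < ereal 1"
    have "(\<lambda>k. (a + of_nat k) * (b + of_nat k) / ((c + of_nat k) * of_nat (Suc k))) \<longlonglongrightarrow> 1"
    proof (rule Lim_transform_eventually)
      have inv: "(\<lambda>k. x / of_nat k :: complex) \<longlonglongrightarrow> 0" for x
        by (intro tendsto_divide_0[OF tendsto_const] tendsto_of_nat)
      have "(\<lambda>k. (a / of_nat k + 1) * (b / of_nat k + 1) / ((c / of_nat k + 1) * (1 / of_nat k + 1)))
          \<longlonglongrightarrow> (0 + 1) * (0 + 1) / ((0 + 1) * (0 + 1))"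
        by (intro tendsto_intros inv) auto
      then show "(\<lambda>k. (a / of_nat k + 1) * (b / of_nat k + 1) / ((c / of_nat k + 1) * (1 / of_nat k + 1))) \<longlonglongrightarrow> 1"
        by simp
      show "eventually (\<lambda>k. (a / of_nat k + 1) * (b / of_nat k + 1) / ((c / of_nat k + 1) * (1 / of_nat k + 1)) =
          (a + of_nat k) * (b + of_nat k) / ((c + of_nat k) * of_nat (Suc k))) sequentially"
        using eventually_gt_at_top[of 0]
      proof eventually_elim
        case (elim k)
        have shift: "x / of_nat k + 1 = (x + of_nat k) / of_nat k" for x :: complex
          using elim by (simp add: field_simps)
        show ?case
          unfolding shift using elim by (simp add: add_ac)
      qed
    qed
    then have "(\<lambda>k. norm ((a + of_nat k) * (b + of_nat k) / ((c + of_nat k) * of_nat (Suc k))) * r) \<longlonglongrightarrow> norm (1 :: complex) * r"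
      by (intro tendsto_intros)
    then have "eventually (\<lambda>k. norm ((a + of_nat k) * (b + of_nat k) / ((c + of_nat k) * of_nat (Suc k))) * r < (1 + r) / 2) sequentially"
      using r by (intro order_tendstoD(2)) auto
    moreover have "eventually (\<lambda>k. c + of_nat k \<noteq> 0) sequentially"
      using eventually_gt_at_top[of "nat \<lceil>norm c\<rceil>"]
    proof eventually_elim
      case (elim k)
      show ?case
      proof
        assume "c + of_nat k = 0"
        then have "norm c = norm (of_nat k :: complex)"
          by (metis add_eq_0_iff norm_minus_cancel)
        with elim show False
          by simp
      qed
    qed
    ultimately have "eventually (\<lambda>k. norm (?a (Suc k) * of_real r ^ Suc k) \<le> (1 + r) / 2 * norm (?a k * of_real r ^ k)) sequentially"
    proof eventually_elim
      case (elim k)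
      let ?q = "(a + of_nat k) * (b + of_nat k) / ((c + of_nat k) * of_nat (Suc k))"
      have "?a (Suc k) = ?a k * ?q"
        using rec[of k] elim(2) of_nat_neq_0[of k, where 'a = complex] by (simp add: divide_simps del: of_nat_Suc)
      then have "norm (?a (Suc k) * of_real r ^ Suc k) = norm ?q * r * norm (?a k * of_real r ^ k)"
        using r by (simp add: norm_mult norm_power norm_divide)
      also have "\<dots> \<le> (1 + r) / 2 * norm (?a k * of_real r ^ k)"
        using elim(1) by (intro mult_right_mono) auto
      finally show ?case .
    qed
    then obtain N where "\<And>k. k \<ge> N \<Longrightarrow> norm (?a (Suc k) * of_real r ^ Suc k) \<le> (1 + r) / 2 * norm (?a k * of_real r ^ k)"
      by (auto simp: eventually_at_top_linorder)
    then show "summable (\<lambda>k. ?a k * of_real r ^ k)"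
      by (rule summable_ratio_test[rotated]) (use r in auto)
  qed
  then show ?thesis
    by (simp add: fps_conv_radius_def hyp2F1_fps_def one_ereal_def)
qed

lemma has_fps_expansion_transform:
  assumes "f has_fps_expansion F" "eventually (\<lambda>x. f x = g x) (nhds 0)"
  shows "g has_fps_expansion F"
  using assms has_fps_expansion_cong by blast

lemma hyp2F1_commute: "hyp2F1 a b c = hyp2F1 b a c"
proof -
  have "hyp2F1_coeff a b c = hyp2F1_coeff b a c"
    by (auto simp: hyp2F1_coeff_def)
  then show ?thesis
    unfolding hyp2F1_def by simp
qed

lemma hyp2F1_fps_commute: "hyp2F1_fps a b c = hyp2F1_fps b a c"
  by (auto simp: hyp2F1_fps_def fps_eq_iff hyp2F1_coeff_def)

text \<open>
  The definite description behind \<^const>\<open>hyp2F1\<close> carries information only once a function satisfying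
  it has been exhibited; \<open>f\<close> is such a witness and hands its regularity over.
\<close>

lemma hyp2F1_holomorphic_has_fps_expansion:
  assumes "f holomorphic_on cut_plane" "f has_fps_expansion hyp2F1_fps a b c"
  shows "hyp2F1 a b c holomorphic_on cut_plane" "hyp2F1 a b c has_fps_expansion hyp2F1_fps a b c"
proof -
  note eq = hyp2F1_eqI[OF assms]
  show "hyp2F1 a b c holomorphic_on cut_plane"
    using assms(1) by (rule holomorphic_transform) (simp add: eq)
  have "eventually (\<lambda>z. z \<in> cut_plane) (nhds 0)"
    by (intro eventually_nhds_in_open open_cut_plane zero_in_cut_plane)
  then have "eventually (\<lambda>z. hyp2F1 a b c z = f z) (nhds 0)"
    by eventually_elim (rule eq)
  then show "hyp2F1 a b c has_fps_expansion hyp2F1_fps a b c"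
    by (intro has_fps_expansion_transform[OF assms(2)]) (simp add: eq_commute)
qed

section \<open>Continuation of the families with parameters a, a + 1/2 and c = 2b\<close>

lemma Re_csqrt_pos:
  assumes "z \<notin> \<real>\<^sub>\<le>\<^sub>0"
  shows "Re (csqrt z) > 0"
proof (rule ccontr)
  assume "\<not> Re (csqrt z) > 0"
  then have "Re (csqrt z) = 0"
    using Re_csqrt[of z] by simp
  then have "Re ((csqrt z)\<^sup>2) \<le> 0 \<and> Im ((csqrt z)\<^sup>2) = 0"
    by (simp add: power2_eq_square)
  with assms show False
    by (simp add: complex_nonpos_Reals_iff)
qed

lemma square_notin_nonpos_Reals:
  assumes "Re z > 0"
  shows "z\<^sup>2 \<notin> \<real>\<^sub>\<le>\<^sub>0"
  using assms by (auto simp: complex_nonpos_Reals_iff power2_eq_square mult_le_0_iff)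

lemma Re_inverse_pos: "Re z > 0 \<Longrightarrow> Re (inverse z) > 0"
  by (auto simp: Re_complex_div_gt_0 inverse_eq_divide intro!: divide_pos_pos sum_power2_gt_zero_iff)

text \<open>
  The inverse of \<open>v \<mapsto> 4 v / (1 + v)\<^sup>2\<close>, a rotated Koebe function, from the cut plane to the unit
  disc. It is the Cayley transform of \<open>\<surd>(1 - x)\<close>, which lies in the right half-plane.
\<close>

definition koebe_inv :: "complex \<Rightarrow> complex" where
  "koebe_inv x = (1 - csqrt (1 - x)) / (1 + csqrt (1 - x))"

lemma norm_koebe_inv_less:
  assumes "x \<in> cut_plane"
  shows "norm (koebe_inv x) < 1"
proof -
  let ?s = "csqrt (1 - x)"
  have s: "Re ?s > 0"
    using assms by (intro Re_csqrt_pos) (simp add: cut_plane_iff)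
  then have "(norm (1 - ?s))\<^sup>2 < (norm (1 + ?s))\<^sup>2"
    unfolding cmod_power2 by (simp add: power2_eq_square algebra_simps)
  then have "norm (1 - ?s) < norm (1 + ?s)"
    by (rule power_less_imp_less_base) simp
  then show ?thesis
    unfolding koebe_inv_def norm_divide by (subst divide_less_eq_1_pos) (auto intro: le_less_trans[OF norm_ge_zero])
qed

lemma koebe_inv_holomorphic: "koebe_inv holomorphic_on cut_plane"
proof -
  have "1 + csqrt (1 - x) \<noteq> 0" if "x \<in> cut_plane" for x
  proof -
    have "Re (csqrt (1 - x)) > 0"
      using that by (intro Re_csqrt_pos) (simp add: cut_plane_iff)
    then have "Re (1 + csqrt (1 - x)) > 0"
      by (simp only: plus_complex.sel one_complex.sel)
    then show ?thesis
      by (metis less_irrefl zero_complex.sel(1))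
  qed
  then show ?thesis
    unfolding koebe_inv_def by (intro holomorphic_intros) (auto simp: cut_plane_iff)
qed

lemma koebe_inv_koebe:
  assumes "norm u < 1"
  shows "koebe_inv (4 * u / (1 + u)\<^sup>2) = u"
proof -
  have nz: "1 + u \<noteq> 0"
    using assms by (metis add_eq_0_iff norm_minus_cancel norm_one order_less_irrefl)
  have "(Re u)\<^sup>2 + (Im u)\<^sup>2 < 1"
    using assms by (simp add: abs_square_less_1 flip: cmod_power2)
  then have "0 < Re ((1 - u) / (1 + u))"
    by (simp add: Re_complex_div_gt_0 power2_eq_square algebra_simps)
  moreover have "((1 - u) / (1 + u))\<^sup>2 = 1 - 4 * u / (1 + u)\<^sup>2"
    using nz by (simp add: power_divide divide_simps) (simp add: power2_eq_square algebra_simps)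
  ultimately have root: "csqrt (1 - 4 * u / (1 + u)\<^sup>2) = (1 - u) / (1 + u)"
    by (intro csqrt_unique) auto
  have "1 - (1 - u) / (1 + u) = 2 * u / (1 + u)" "1 + (1 - u) / (1 + u) = 2 / (1 + u)"
    using nz by (simp_all add: field_simps)
  then show ?thesis
    using nz unfolding koebe_inv_def root by simp
qed

text \<open>
  The continuation \<open>f\<close> is the right-hand side of the transformation read at \<open>v = koebe_inv x\<close>. Its
  Taylor series at 0 is not computed directly: the composition with \<open>v \<mapsto> 4 v / (1 + v)\<^sup>2\<close> has a known
  expansion, and composition with a series of order exactly 1 is injective.
\<close>

lemma hyp2F1_half:
  shows "hyp2F1 a (a + 1 / 2) c holomorphic_on cut_plane"
    and "hyp2F1 a (a + 1 / 2) c has_fps_expansion hyp2F1_fps a (a + 1 / 2) c"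
proof -
  let ?G = "hyp2F1_fps (2 * a) (2 * a - c + 1) c"
  let ?X = "fps_const 4 * fps_X ^ 1 * fps_neg_powr (- 1) 2"
  define f where "f = (\<lambda>x. (1 + koebe_inv x) powr (2 * a) * eval_fps ?G (koebe_inv x))"
  have unit_disc: "1 + u \<notin> \<real>\<^sub>\<le>\<^sub>0" if "norm u < 1" for u :: complex
    using that abs_Re_le_cmod[of u] by (auto simp: complex_nonpos_Reals_iff)
  have disc: "ball (0 :: complex) 1 \<subseteq> eball 0 (fps_conv_radius ?G)"
  proof
    fix u :: complex assume "u \<in> ball 0 1"
    then have "ereal (norm u) < 1"
      by simp
    also note hyp2F1_fps_conv_radius
    finally show "u \<in> eball 0 (fps_conv_radius ?G)"
      by (simp add: in_eball_iff)
  qed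
  have "(eval_fps ?G \<circ> koebe_inv) holomorphic_on cut_plane"
    by (intro holomorphic_on_compose_gen[OF koebe_inv_holomorphic holomorphic_on_eval_fps[OF disc]])
       (auto intro: norm_koebe_inv_less)
  then have hol: "f holomorphic_on cut_plane"
    unfolding f_def o_def
    by (intro holomorphic_intros koebe_inv_holomorphic unit_disc norm_koebe_inv_less)
  have "(\<lambda>u::complex. 4 * u * (1 - (- 1) * u) powr (- 2)) has_fps_expansion (fps_const 4 * fps_X) * fps_neg_powr (- 1) 2"
    by (intro fps_expansion_intros has_fps_expansion_neg_powr)
  moreover have small: "eventually (\<lambda>u. norm u < 1) (nhds (0 :: complex))"
    using eventually_nhds_in_open[of "ball 0 (1 :: real)" "0 :: complex"] by simp
  then have "eventually (\<lambda>u::complex. 4 * u * (1 - (- 1) * u) powr (- 2) = 4 * u / (1 + u)\<^sup>2) (nhds 0)"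
  proof eventually_elim
    case (elim u)
    then have "1 + u \<noteq> 0"
      using unit_disc by force
    then show ?case
      by (simp add: powr_minus divide_inverse)
  qed
  ultimately have X: "(\<lambda>u. 4 * u / (1 + u)\<^sup>2) has_fps_expansion ?X"
    unfolding power_one_right by (rule has_fps_expansion_transform)
  have exp_f: "f has_fps_expansion fps_expansion f 0"
    using open_cut_plane zero_in_cut_plane hol by (rule has_fps_expansion_fps_expansion)
  have "(f \<circ> (\<lambda>u. 4 * u / (1 + u)\<^sup>2)) has_fps_expansion (fps_expansion f 0 oo ?X)"
    by (intro has_fps_expansion_compose exp_f X) simp
  moreover have "(f \<circ> (\<lambda>u. 4 * u / (1 + u)\<^sup>2)) has_fps_expansion fps_neg_powr (- 1) (- (2 * a)) * ?G"
  proof -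
    have "(\<lambda>u. (1 - (- 1) * u) powr (- (- (2 * a))) * eval_fps ?G u) has_fps_expansion
        fps_neg_powr (- 1) (- (2 * a)) * ?G"
      by (intro less_le_trans[OF _ hyp2F1_fps_conv_radius] fps_expansion_intros has_fps_expansion_neg_powr eval_fps_has_fps_expansion) simp_all
    moreover have "eventually (\<lambda>u. (1 - (- 1) * u) powr (- (- (2 * a))) * eval_fps ?G u =
        (f \<circ> (\<lambda>u. 4 * u / (1 + u)\<^sup>2)) u) (nhds 0)"
      using small by eventually_elim (simp add: f_def koebe_inv_koebe)
    ultimately show ?thesis
      by (rule has_fps_expansion_transform)
  qed
  ultimately have "fps_expansion f 0 oo ?X = fps_neg_powr (- 1) (- (2 * a)) * ?G"
    by (rule fps_expansion_unique_complex)
  also have "\<dots> = (fps_neg_powr (- 1) (- (2 * a)) * fps_neg_powr (- 1) (2 * a)) * (hyp2F1_fps a (a + 1 / 2) c oo ?X)"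
    by (simp only: hyp2F1_fps_quadratic_half[symmetric] mult.assoc)
  also have "\<dots> = hyp2F1_fps a (a + 1 / 2) c oo ?X"
    by (simp flip: fps_neg_powr_add)
  finally have "fps_expansion f 0 = hyp2F1_fps a (a + 1 / 2) c"
    by (subst (asm) fps_compose_inj_right) (simp_all add: fps_mult_nth)
  with exp_f have "f has_fps_expansion hyp2F1_fps a (a + 1 / 2) c"
    by simp
  from hyp2F1_holomorphic_has_fps_expansion[OF hol this]
  show "hyp2F1 a (a + 1 / 2) c holomorphic_on cut_plane"
    and "hyp2F1 a (a + 1 / 2) c has_fps_expansion hyp2F1_fps a (a + 1 / 2) c" .
qed

lemma one_minus_half_notin_nonpos_Reals: "w \<in> cut_plane \<Longrightarrow> 1 - w / 2 \<notin> \<real>\<^sub>\<le>\<^sub>0"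
  by (auto simp: cut_plane_iff complex_nonpos_Reals_iff)

text \<open>
  With \<open>s = \<surd>(1 - w)\<close> in the right half-plane, \<open>1 - (w / (2 - w))\<^sup>2\<close> is the square of
  \<open>p = 2 / (s + 1 / s)\<close>. As inversion preserves the right half-plane, \<open>p\<close> lies in it, and so \<open>p\<^sup>2\<close>
  avoids \<open>(-\<infinity>, 0]\<close>.
\<close>

lemma quadratic_arg_in_cut_plane:
  assumes "w \<in> cut_plane"
  shows "(w / (2 - w))\<^sup>2 \<in> cut_plane"
proof -
  define s where "s = csqrt (1 - w)"
  have s: "Re s > 0"
    unfolding s_def using assms by (intro Re_csqrt_pos) (simp add: cut_plane_iff)
  have w: "w = 1 - s\<^sup>2"
    by (simp add: s_def)
  define p where "p = 2 * inverse (s + inverse s)"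
  have "Re (s + inverse s) > 0"
    using s Re_inverse_pos[OF s] by (simp only: plus_complex.sel)
  then have "Re (inverse (s + inverse s)) > 0"
    by (rule Re_inverse_pos)
  moreover have "Re p = 2 * Re (inverse (s + inverse s))"
    unfolding p_def by (metis Re_complex_of_real mult_2 plus_complex.sel(1))
  ultimately have "Re p > 0"
    by (simp only:)
  have "s \<noteq> 0"
    using s by auto
  have "w \<noteq> 2"
    using one_minus_half_notin_nonpos_Reals[OF assms] by auto
  then have nz: "1 + s\<^sup>2 \<noteq> 0"
  proof (intro notI)
    assume "1 + s\<^sup>2 = 0"
    then have "s\<^sup>2 = - 1"
      by (simp add: add_eq_0_iff)
    with \<open>w \<noteq> 2\<close> show False
      by (simp add: w)
  qed
  have p: "p = 2 * s / (1 + s\<^sup>2)"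
    using \<open>s \<noteq> 0\<close> nz by (simp add: p_def field_simps power2_eq_square)
  then have "1 - (w / (2 - w))\<^sup>2 = p\<^sup>2"
    unfolding w p using nz by (simp add: power_divide divide_simps) (simp add: algebra_simps power2_eq_square)
  with square_notin_nonpos_Reals[OF \<open>Re p > 0\<close>] show ?thesis
    by (simp add: cut_plane_iff)
qed

text \<open>
  The right-hand side of the quadratic transformation is itself the continuation, so one function
  yields both regularity and the transformation. It is holomorphic because \<open>1 - w / 2\<close> avoids the cut
  of the principal power and \<open>(w / (2 - w))\<^sup>2\<close> stays in the cut plane.
\<close>

lemma hyp2F1_double:
  shows hyp2F1_double_holomorphic: "hyp2F1 a b (2 * b) holomorphic_on cut_plane"
    and hyp2F1_double_has_fps_expansion: "hyp2F1 a b (2 * b) has_fps_expansion hyp2F1_fps a b (2 * b)"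
    and hyp2F1_quadratic: "w \<in> cut_plane \<Longrightarrow> hyp2F1 a b (2 * b) w =
      2 powr (1 - 2 * b) * of_real (sqrt pi) * rGamma b * ((1 - w / 2) powr (- a) *
        hyp2F1 (a / 2) (a / 2 + 1 / 2) (b + 1 / 2) ((w / (2 - w))\<^sup>2))"
proof -
  let ?F = "hyp2F1 (a / 2) (a / 2 + 1 / 2) (b + 1 / 2)"
  let ?C = "2 powr (1 - 2 * b) * of_real (sqrt pi) * rGamma b"
  let ?q = "\<lambda>w :: complex. (w / (2 - w))\<^sup>2"
  define f where "f = (\<lambda>w. ?C * ((1 - w / 2) powr (- a) * ?F (?q w)))"
  have nz: "2 - w \<noteq> 0" if "w \<in> cut_plane" for w
    using one_minus_half_notin_nonpos_Reals[OF that] by auto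
  have "?q holomorphic_on cut_plane"
    by (intro holomorphic_intros nz)
  then have "(?F \<circ> ?q) holomorphic_on cut_plane"
    by (rule holomorphic_on_compose_gen[OF _ hyp2F1_half(1)]) (auto intro: quadratic_arg_in_cut_plane)
  then have hol: "f holomorphic_on cut_plane"
    unfolding f_def o_def
    by (intro holomorphic_intros) (auto dest: one_minus_half_notin_nonpos_Reals)
  have "(\<lambda>w. (1 / 4 * w ^ 2) * (1 - 1 / 2 * w) powr (- 2)) has_fps_expansion
      fps_const (1 / 4) * fps_X ^ 2 * fps_neg_powr (1 / 2) 2"
    by (intro fps_expansion_intros has_fps_expansion_neg_powr)
  moreover have "eventually (\<lambda>w. w \<in> cut_plane) (nhds 0)"
    by (intro eventually_nhds_in_open open_cut_plane zero_in_cut_plane)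
  then have "eventually (\<lambda>w. (1 / 4 * w ^ 2) * (1 - 1 / 2 * w) powr (- 2) = ?q w) (nhds 0)"
  proof eventually_elim
    case (elim w)
    have "1 - 1 / 2 * w = (2 - w) / 2"
      by (simp add: field_simps)
    then show ?case
      using nz[OF elim] by (simp add: powr_minus power_divide field_simps)
  qed
  ultimately have "?q has_fps_expansion fps_const (1 / 4) * fps_X ^ 2 * fps_neg_powr (1 / 2) 2"
    by (rule has_fps_expansion_transform)
  then have "(?F \<circ> ?q) has_fps_expansion
      (hyp2F1_fps (a / 2) (a / 2 + 1 / 2) (b + 1 / 2) oo (fps_const (1 / 4) * fps_X ^ 2 * fps_neg_powr (1 / 2) 2))"
    by (intro has_fps_expansion_compose hyp2F1_half(2)) simp_all
  then have "(\<lambda>w. ?C * ((1 - 1 / 2 * w) powr (- a) * (?F \<circ> ?q) w)) has_fps_expansion hyp2F1_fps a b (2 * b)"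
    unfolding hyp2F1_fps_quadratic_double[of b a, symmetric]
    by (intro has_fps_expansion_cmult_left has_fps_expansion_mult has_fps_expansion_neg_powr)
  then have exp: "f has_fps_expansion hyp2F1_fps a b (2 * b)"
    by (simp add: f_def o_def)
  show "hyp2F1 a b (2 * b) holomorphic_on cut_plane"
    and "hyp2F1 a b (2 * b) has_fps_expansion hyp2F1_fps a b (2 * b)"
    by (rule hyp2F1_holomorphic_has_fps_expansion[OF hol exp])+
  show "hyp2F1 a b (2 * b) w = ?C * ((1 - w / 2) powr (- a) * ?F (?q w))" if "w \<in> cut_plane"
    using hyp2F1_eqI[OF hol exp that] by (simp add: f_def)
qed

text \<open>
  For \<open>c = 2 b\<close> the Pfaff transformation in the parameter \<open>b\<close> stays in the family
  \<open>F(\<cdot>, b; 2 b; \<cdot>)\<close>, whose continuation is available, and replaces \<open>a\<close> by \<open>2 b - a\<close>.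
\<close>

lemma hyp2F1_double_Pfaff:
  assumes "w \<in> cut_plane"
  shows "hyp2F1 a b (2 * b) w = (1 - w) powr (- b) * hyp2F1 (2 * b - a) b (2 * b) (w / (w - 1))"
    and "w / (w - 1) \<in> cut_plane"
proof -
  let ?F = "hyp2F1 (2 * b - a) b (2 * b)"
  let ?q = "\<lambda>w :: complex. w / (w - 1)"
  define f where "f = (\<lambda>w. (1 - w) powr (- b) * ?F (?q w))"
  have nz: "w - 1 \<noteq> 0" if "w \<in> cut_plane" for w
    using that by (auto simp: cut_plane_iff)
  have q: "?q w \<in> cut_plane" if "w \<in> cut_plane" for w
  proof -
    have "1 - ?q w = inverse (1 - w)"
      using nz[OF that] by (simp add: field_simps)
    then show ?thesis
      using that by (simp add: cut_plane_iff)
  qed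
  have "?q holomorphic_on cut_plane"
    by (intro holomorphic_intros nz)
  then have "(?F \<circ> ?q) holomorphic_on cut_plane"
    by (rule holomorphic_on_compose_gen[OF _ hyp2F1_double_holomorphic]) (auto intro: q)
  then have hol: "f holomorphic_on cut_plane"
    unfolding f_def o_def
    by (intro holomorphic_intros) (auto simp: cut_plane_iff)
  have "(\<lambda>w. (- 1 * w ^ 1) * (1 - 1 * w) powr (- 1)) has_fps_expansion
      fps_const (- 1) * fps_X ^ 1 * fps_neg_powr 1 1"
    by (intro fps_expansion_intros has_fps_expansion_neg_powr)
  moreover have "eventually (\<lambda>w. w \<in> cut_plane) (nhds 0)"
    by (intro eventually_nhds_in_open open_cut_plane zero_in_cut_plane)
  then have "eventually (\<lambda>w. (- 1 * w ^ 1) * (1 - 1 * w) powr (- 1) = ?q w) (nhds 0)"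
  proof eventually_elim
    case (elim w)
    then show ?case
      using nz[OF elim] by (simp add: powr_minus field_simps)
  qed
  ultimately have "?q has_fps_expansion fps_const (- 1) * fps_X ^ 1 * fps_neg_powr 1 1"
    by (rule has_fps_expansion_transform)
  then have "(?F \<circ> ?q) has_fps_expansion
      (hyp2F1_fps (2 * b - a) b (2 * b) oo (fps_const (- 1) * fps_X ^ 1 * fps_neg_powr 1 1))"
    by (intro has_fps_expansion_compose hyp2F1_double_has_fps_expansion) simp_all
  then have "(\<lambda>w. (1 - 1 * w) powr (- b) * (?F \<circ> ?q) w) has_fps_expansion hyp2F1_fps b a (2 * b)"
    unfolding hyp2F1_fps_Pfaff[of b "2 * b" a, symmetric] hyp2F1_fps_commute[of b "2 * b - a"]
    by (intro has_fps_expansion_mult has_fps_expansion_neg_powr)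
  then have exp: "f has_fps_expansion hyp2F1_fps a b (2 * b)"
    by (simp add: f_def o_def hyp2F1_fps_commute)
  show "hyp2F1 a b (2 * b) w = (1 - w) powr (- b) * ?F (?q w)"
    using hyp2F1_eqI[OF hol exp assms] by (simp add: f_def)
  show "?q w \<in> cut_plane"
    using q assms .
qed

section \<open>The Jacobi and Legendre functions\<close>

text \<open>
  The arguments of two points on the same side of the real axis (or both on the positive axis)
  differ by less than \<open>\<pi>\<close>.
\<close>

lemma Ln_divide_same_Im:
  assumes "Im x = Im y" "x \<notin> \<real>\<^sub>\<le>\<^sub>0" "y \<notin> \<real>\<^sub>\<le>\<^sub>0"
  shows "Ln (x / y) = Ln x - Ln y" and "x / y \<notin> \<real>\<^sub>\<le>\<^sub>0"
proof -
  have nz: "x \<noteq> 0" "y \<noteq> 0"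
    using assms by auto
  have "\<bar>Im (Ln x) - Im (Ln y)\<bar> < pi"
  proof (cases "Im x" "0 :: real" rule: linorder_cases)
    case less
    then have "Im (Ln x) < 0" "Im (Ln y) < 0"
      using Im_Ln_pos_le[of x] Im_Ln_pos_le[of y] Im_Ln_le_pi[of x] Im_Ln_le_pi[of y] nz assms(1) by auto
    then show ?thesis
      using mpi_less_Im_Ln[OF nz(1)] mpi_less_Im_Ln[OF nz(2)] by linarith
  next
    case equal
    then have "Im (Ln x) = 0" "Im (Ln y) = 0"
      using assms nz by (auto simp: Im_Ln_eq_0 complex_nonpos_Reals_iff)
    then show ?thesis
      by simp
  next
    case greater
    then show ?thesis
      using Im_Ln_pos_lt_imp[of x] Im_Ln_pos_lt_imp[of y] assms(1) by auto
  qed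
  moreover from this show Ln: "Ln (x / y) = Ln x - Ln y"
    using nz by (intro Ln_unique) (auto simp: exp_diff)
  ultimately have "Im (Ln (x / y)) \<noteq> pi"
    by auto
  moreover have "x / y \<noteq> 0"
    using nz by simp
  ultimately show "x / y \<notin> \<real>\<^sub>\<le>\<^sub>0"
    using Im_Ln_eq_pi[of "x / y"] complex_eq_iff[of "x / y" 0]
    unfolding complex_nonpos_Reals_iff zero_complex.sel by linarith
qed

lemma slit_plane_shifts:
  assumes "z \<notin> complex_of_real ` {..1}"
  shows "z - 1 \<notin> \<real>\<^sub>\<le>\<^sub>0" "z \<notin> \<real>\<^sub>\<le>\<^sub>0" "z + 1 \<notin> \<real>\<^sub>\<le>\<^sub>0"
proof -
  have "\<not> (Re z \<le> 1 \<and> Im z = 0)"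
    using assms by (auto simp: image_iff complex_eq_iff)
  then show "z - 1 \<notin> \<real>\<^sub>\<le>\<^sub>0" "z \<notin> \<real>\<^sub>\<le>\<^sub>0" "z + 1 \<notin> \<real>\<^sub>\<le>\<^sub>0"
    by (auto simp: complex_nonpos_Reals_iff)
qed

lemma Ln_quotients:
  assumes "z \<notin> complex_of_real ` {..1}"
  shows "Ln (z / (z - 1)) = Ln z - Ln (z - 1)"
    and "Ln (z / (z + 1)) = Ln z - Ln (z + 1)"
    and "Ln ((z + 1) / (z - 1)) = Ln (z + 1) - Ln (z - 1)"
    and "Ln ((z - 1) / (z + 1)) = Ln (z - 1) - Ln (z + 1)"
    and "(z + 1) / (z - 1) \<notin> \<real>\<^sub>\<le>\<^sub>0"
  by (intro Ln_divide_same_Im slit_plane_shifts[OF assms]; simp)+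

text \<open>
  The two expressions of the hypergeometric factor of the Jacobi function through that of a
  Legendre function: without and with a preceding Pfaff transformation. The powers are written as
  exponentials of logarithms of \<open>z\<close> and \<open>z \<plusminus> 1\<close> so that they can be collected.
\<close>

lemma hyp2F1_double_at_2_div_one_minus:
  assumes z: "z \<notin> complex_of_real ` {..1}"
  shows "hyp2F1 a b (2 * b) (2 / (1 - z)) =
      2 powr (1 - 2 * b) * of_real (sqrt pi) * rGamma b * (exp (- a * (Ln z - Ln (z - 1))) *
        hyp2F1 (a / 2) (a / 2 + 1 / 2) (b + 1 / 2) (1 / z\<^sup>2))"
    and "hyp2F1 a b (2 * b) (2 / (1 - z)) =
      2 powr (1 - 2 * b) * of_real (sqrt pi) * rGamma b *
       (exp (- b * (Ln (z + 1) - Ln (z - 1))) * exp ((a - 2 * b) * (Ln z - Ln (z + 1))) *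
        hyp2F1 ((2 * b - a) / 2) ((2 * b - a) / 2 + 1 / 2) (b + 1 / 2) (1 / z\<^sup>2))"
proof -
  define w where "w = 2 / (1 - z)"
  note Ln = Ln_quotients[OF z]
  have nz: "z \<noteq> 0" "z - 1 \<noteq> 0" "z + 1 \<noteq> 0" "1 - z \<noteq> 0"
    using slit_plane_shifts[OF z] by auto
  have w1: "1 - w = (z + 1) / (z - 1)" and w2: "1 - w / 2 = z / (z - 1)"
    and w3: "w / (2 - w) = - 1 / z" and w4: "w / (w - 1) = 2 / (z + 1)"
    using nz by (simp_all add: w_def divide_simps) (simp_all add: algebra_simps)
  have w: "w \<in> cut_plane"
    using Ln(5) by (simp add: cut_plane_iff w1)
  have "hyp2F1 a b (2 * b) w = 2 powr (1 - 2 * b) * of_real (sqrt pi) * rGamma b * ((z / (z - 1)) powr (- a) *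
        hyp2F1 (a / 2) (a / 2 + 1 / 2) (b + 1 / 2) (1 / z\<^sup>2))"
    unfolding hyp2F1_quadratic[OF w] w2 w3 by (simp add: power_divide)
  then show "hyp2F1 a b (2 * b) (2 / (1 - z)) =
      2 powr (1 - 2 * b) * of_real (sqrt pi) * rGamma b * (exp (- a * (Ln z - Ln (z - 1))) *
        hyp2F1 (a / 2) (a / 2 + 1 / 2) (b + 1 / 2) (1 / z\<^sup>2))"
    using nz by (simp add: w_def powr_def Ln)
  define v where "v = 2 / (z + 1)"
  have v2: "1 - v / 2 = z / (z + 1)" and v3: "v / (2 - v) = 1 / z"
  proof -
    have *: "2 - v = 2 * (z / (z + 1))"
      using nz by (simp add: v_def field_simps)
    have "1 - v / 2 = (2 - v) / 2"
      by (simp add: field_simps)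
    also have "\<dots> = z / (z + 1)"
      unfolding * by (rule nonzero_mult_div_cancel_left) simp
    finally show "1 - v / 2 = z / (z + 1)" .
    show "v / (2 - v) = 1 / z"
    proof -
      have "2 / c / (2 * (x / c)) = 1 / x" if "c \<noteq> 0" for c x :: complex
        using that by simp
      then show ?thesis
        unfolding * unfolding v_def using nz by blast
    qed
  qed
  have v: "v \<in> cut_plane"
    using hyp2F1_double_Pfaff(2)[OF w] by (simp add: v_def w4)
  have "hyp2F1 a b (2 * b) w = ((z + 1) / (z - 1)) powr (- b) * hyp2F1 (2 * b - a) b (2 * b) v"
    using hyp2F1_double_Pfaff(1)[OF w] by (simp only: v_def w4 w1)
  also have "hyp2F1 (2 * b - a) b (2 * b) v = 2 powr (1 - 2 * b) * of_real (sqrt pi) * rGamma b * ((z / (z + 1)) powr (a - 2 * b) *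
        hyp2F1 ((2 * b - a) / 2) ((2 * b - a) / 2 + 1 / 2) (b + 1 / 2) (1 / z\<^sup>2))"
    unfolding hyp2F1_quadratic[OF v] v2 v3 by (simp add: power_divide)
  finally show "hyp2F1 a b (2 * b) (2 / (1 - z)) =
      2 powr (1 - 2 * b) * of_real (sqrt pi) * rGamma b *
       (exp (- b * (Ln (z + 1) - Ln (z - 1))) * exp ((a - 2 * b) * (Ln z - Ln (z + 1))) *
        hyp2F1 ((2 * b - a) / 2) ((2 * b - a) / 2 + 1 / 2) (b + 1 / 2) (1 / z\<^sup>2))"
    using nz by (simp add: w_def powr_def Ln mult_ac)
qed

lemma Gamma_plus_1_nonzero:
  assumes "x \<notin> neg_Nats"
  shows "Gamma (x + 1) \<noteq> 0"
proof -
  have "x + 1 \<notin> \<int>\<^sub>\<le>\<^sub>0"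
  proof
    assume "x + 1 \<in> \<int>\<^sub>\<le>\<^sub>0"
    then obtain n where "x + 1 = - of_nat n"
      by (auto elim: nonpos_Ints_cases')
    then have "x = - of_nat (Suc n)"
      by (metis add_diff_cancel_right' minus_add_distrib of_nat_Suc diff_minus_eq_add uminus_add_conv_diff diff_conv_add_uminus add.commute)
    then have "x \<in> neg_Nats"
      unfolding neg_Nats_def by (intro image_eqI[of _ _ "Suc n"]) auto
    with assms show False by simp
  qed
  then show ?thesis
    by (simp add: Gamma_eq_zero_iff)
qed

theorem theorem2p18:
  fixes \<alpha> \<gamma> z :: complex
  assumes "z \<notin> complex_of_real ` {..1}"
  shows "(\<alpha> + \<gamma> \<notin> neg_Nats \<longrightarrow>
            (\<gamma> \<notin> neg_Nats \<longrightarrow>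
               Jacobi_Q \<gamma> \<alpha> \<alpha> z =
                 2 powr \<alpha> * exp (\<i> * of_real pi * \<alpha>) * Gamma (\<alpha> + \<gamma> + 1)
                   / (Gamma (\<gamma> + 1) * sq_minus_one_powr z (\<alpha> / 2))
                   * Legendre_Q (\<alpha> + \<gamma>) (- \<alpha>) z) \<and>
            (2 * \<alpha> + \<gamma> \<notin> neg_Nats \<longrightarrow>
               Jacobi_Q \<gamma> \<alpha> \<alpha> z =
                 2 powr \<alpha> * exp (- \<i> * of_real pi * \<alpha>) * Gamma (\<alpha> + \<gamma> + 1)
                   / (Gamma (2 * \<alpha> + \<gamma> + 1) * sq_minus_one_powr z (\<alpha> / 2))
                   * Legendre_Q (\<alpha> + \<gamma>) \<alpha> z)) \<and>
         (\<gamma> - \<alpha> \<notin> neg_Nats \<and> \<gamma> + \<alpha> \<notin> neg_Nats \<longrightarrow>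
            Jacobi_Q \<gamma> \<alpha> (- \<alpha>) z =
              exp (- \<i> * of_real pi * \<alpha>) * Gamma (\<gamma> - \<alpha> + 1) * rGamma (\<gamma> + 1)
                * ((z + 1) / (z - 1)) powr (\<alpha> / 2) * Legendre_Q \<gamma> \<alpha> z \<and>
            Jacobi_Q \<gamma> (- \<alpha>) \<alpha> z =
              exp (- \<i> * of_real pi * \<alpha>) * Gamma (\<gamma> - \<alpha> + 1) * rGamma (\<gamma> + 1)
                * ((z - 1) / (z + 1)) powr (\<alpha> / 2) * Legendre_Q \<gamma> \<alpha> z)"
proof -
  let ?F = "\<lambda>a c. hyp2F1 (a / 2) (a / 2 + 1 / 2) c (1 / z\<^sup>2)"
  have nz: "z \<noteq> 0" "z - 1 \<noteq> 0" "z + 1 \<noteq> 0"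
    using slit_plane_shifts[OF assms] by auto
  define L where "L = Ln z"
  define Lp where "Lp = Ln (z + 1)"
  define Lm where "Lm = Ln (z - 1)"
  define l2 where "l2 = Ln (2 :: complex)"
  have powr: "z powr x = exp (x * L)" "(z + 1) powr x = exp (x * Lp)" "(z - 1) powr x = exp (x * Lm)"
    "2 powr x = exp (x * l2)" "((z + 1) / (z - 1)) powr x = exp (x * (Lp - Lm))"
    "((z - 1) / (z + 1)) powr x = exp (x * (Lm - Lp))" for x
    using nz Ln_quotients[OF assms] by (simp_all add: powr_def L_def Lp_def Lm_def l2_def)
  note hyp = hyp2F1_double_at_2_div_one_minus[OF assms, folded L_def Lp_def Lm_def, unfolded powr]
  \<comment> \<open>Every function involved is brought to the form of Gamma factors times a hypergeometric value times
    a single exponential, after which the exponents are compared linearly.\<close>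
  have Q: "Legendre_Q \<nu> \<mu> z = of_real (sqrt pi) * Gamma (\<nu> + \<mu> + 1) * ?F (\<nu> + \<mu> + 1) (\<nu> + 3 / 2) *
      exp (\<i> * of_real pi * \<mu> + (\<mu> / 2 * Lp + \<mu> / 2 * Lm) - (\<nu> + 1) * l2 - (\<nu> + \<mu> + 1) * L)" for \<nu> \<mu>
  proof -
    have "(\<nu> + \<mu> + 2) / 2 = (\<nu> + \<mu> + 1) / 2 + 1 / 2"
      by (simp add: field_simps)
    then show ?thesis
      unfolding Legendre_Q_def sq_minus_one_powr_def powr
      by (simp only: exp_add exp_diff) (simp only: divide_inverse inverse_mult_distrib mult_ac)
  qed
  \<comment> \<open>The two forms arise without and with the Pfaff transformation. For equal upper parameters \<open>b\<close> is
    the second parameter of the hypergeometric function, for opposite ones it is the first.\<close>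
  have J1: "Jacobi_Q \<gamma> \<alpha> \<beta> z = of_real (sqrt pi) * Gamma (\<alpha> + \<gamma> + 1) * Gamma (\<beta> + \<gamma> + 1) * rGamma b * ?F a (b + 1 / 2) *
      exp ((\<alpha> + \<beta> + \<gamma>) * l2 + (1 - 2 * b) * l2 - (\<alpha> + \<gamma> + 1) * Lm - \<beta> * Lp + - a * (L - Lm))"
    if "hyp2F1 (\<gamma> + 1) (\<alpha> + \<gamma> + 1) (\<alpha> + \<beta> + 2 * \<gamma> + 2) = hyp2F1 a b (2 * b)" for \<alpha> \<beta> \<gamma> a b
    unfolding Jacobi_Q_def powr that hyp(1)
    by (simp only: exp_add exp_diff) (simp only: divide_inverse inverse_mult_distrib mult_ac)
  have J2: "Jacobi_Q \<gamma> \<alpha> \<beta> z = of_real (sqrt pi) * Gamma (\<alpha> + \<gamma> + 1) * Gamma (\<beta> + \<gamma> + 1) * rGamma b * ?F (2 * b - a) (b + 1 / 2) *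
      exp ((\<alpha> + \<beta> + \<gamma>) * l2 + (1 - 2 * b) * l2 - (\<alpha> + \<gamma> + 1) * Lm - \<beta> * Lp + - b * (Lp - Lm) + (a - 2 * b) * (L - Lp))"
    if "hyp2F1 (\<gamma> + 1) (\<alpha> + \<gamma> + 1) (\<alpha> + \<beta> + 2 * \<gamma> + 2) = hyp2F1 a b (2 * b)" for \<alpha> \<beta> \<gamma> a b
    unfolding Jacobi_Q_def powr that hyp(2)
    by (simp only: exp_add exp_diff) (simp only: divide_inverse inverse_mult_distrib mult_ac)
  have equal: "hyp2F1 (\<gamma> + 1) (\<alpha> + \<gamma> + 1) (\<alpha> + \<alpha> + 2 * \<gamma> + 2) =
      hyp2F1 (\<gamma> + 1) (\<alpha> + \<gamma> + 1) (2 * (\<alpha> + \<gamma> + 1))"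
    by (simp add: algebra_simps)
  have opposite: "hyp2F1 (\<gamma> + 1) (\<alpha> + \<gamma> + 1) (\<alpha> + - \<alpha> + 2 * \<gamma> + 2) =
      hyp2F1 (\<alpha> + \<gamma> + 1) (\<gamma> + 1) (2 * (\<gamma> + 1))" for \<alpha>
    using hyp2F1_commute[of "\<gamma> + 1" "\<alpha> + \<gamma> + 1"] by (simp add: algebra_simps)
  have prefactor_a: "2 powr u * exp p * g / (h * sq_minus_one_powr z s) * (A * exp y) =
      g / h * A * exp (u * l2 + p - (s * Lp + s * Lm) + y)" for u p g h s A y
    unfolding powr sq_minus_one_powr_def
    by (simp only: exp_add exp_diff) (simp only: divide_inverse inverse_mult_distrib mult_ac)
  have prefactor_b: "exp p * g * h * exp v * (A * exp y) = g * h * A * exp (p + v + y)"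
    for p g h v A y :: complex
    by (simp add: exp_add mult_ac)
  have Gamma_rGamma: "Gamma (x + 1) * rGamma (x + 1) = 1" if "x \<notin> neg_Nats" for x
    using Gamma_plus_1_nonzero[OF that] by (simp add: rGamma_inverse_Gamma)
  have half: "x + 1 + 1 / 2 = x + 3 / 2" for x :: complex
    by simp
  show ?thesis
  proof (intro conjI impI; (elim conjE)?)
    assume 1: "\<alpha> + \<gamma> \<notin> neg_Nats" and 2: "\<gamma> \<notin> neg_Nats"
    have deg: "\<alpha> + \<gamma> + - \<alpha> + 1 = \<gamma> + 1"
      by simp
    show "Jacobi_Q \<gamma> \<alpha> \<alpha> z = 2 powr \<alpha> * exp (\<i> * of_real pi * \<alpha>) * Gamma (\<alpha> + \<gamma> + 1)
        / (Gamma (\<gamma> + 1) * sq_minus_one_powr z (\<alpha> / 2)) * Legendre_Q (\<alpha> + \<gamma>) (- \<alpha>) z"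
      unfolding J1[OF equal] Q prefactor_a half deg
    proof (rule arg_cong2[where f = "(*)"])
      show "of_real (sqrt pi) * Gamma (\<alpha> + \<gamma> + 1) * Gamma (\<alpha> + \<gamma> + 1) * rGamma (\<alpha> + \<gamma> + 1) *
          ?F (\<gamma> + 1) (\<alpha> + \<gamma> + 3 / 2) = Gamma (\<alpha> + \<gamma> + 1) / Gamma (\<gamma> + 1) *
          (of_real (sqrt pi) * Gamma (\<gamma> + 1) * ?F (\<gamma> + 1) (\<alpha> + \<gamma> + 3 / 2))"
        using Gamma_rGamma[OF 1] Gamma_plus_1_nonzero[OF 2] by simp
    qed (rule arg_cong[where f = exp], simp add: field_simps)
  next
    assume 1: "\<alpha> + \<gamma> \<notin> neg_Nats" and 2: "2 * \<alpha> + \<gamma> \<notin> neg_Nats"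
    have deg: "\<alpha> + \<gamma> + \<alpha> + 1 = 2 * \<alpha> + \<gamma> + 1" "2 * (\<alpha> + \<gamma> + 1) - (\<gamma> + 1) = 2 * \<alpha> + \<gamma> + 1"
      by (simp_all add: algebra_simps)
    show "Jacobi_Q \<gamma> \<alpha> \<alpha> z = 2 powr \<alpha> * exp (- \<i> * of_real pi * \<alpha>) * Gamma (\<alpha> + \<gamma> + 1)
        / (Gamma (2 * \<alpha> + \<gamma> + 1) * sq_minus_one_powr z (\<alpha> / 2)) * Legendre_Q (\<alpha> + \<gamma>) \<alpha> z"
      unfolding J2[OF equal] Q prefactor_a half deg
    proof (rule arg_cong2[where f = "(*)"])
      show "of_real (sqrt pi) * Gamma (\<alpha> + \<gamma> + 1) * Gamma (\<alpha> + \<gamma> + 1) * rGamma (\<alpha> + \<gamma> + 1) *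
          ?F (2 * \<alpha> + \<gamma> + 1) (\<alpha> + \<gamma> + 3 / 2) = Gamma (\<alpha> + \<gamma> + 1) / Gamma (2 * \<alpha> + \<gamma> + 1) *
          (of_real (sqrt pi) * Gamma (2 * \<alpha> + \<gamma> + 1) * ?F (2 * \<alpha> + \<gamma> + 1) (\<alpha> + \<gamma> + 3 / 2))"
        using Gamma_rGamma[OF 1] Gamma_plus_1_nonzero[OF 2] by simp
    qed (rule arg_cong[where f = exp], simp add: field_simps)
  next
    show "Jacobi_Q \<gamma> \<alpha> (- \<alpha>) z = exp (- \<i> * of_real pi * \<alpha>) * Gamma (\<gamma> - \<alpha> + 1) * rGamma (\<gamma> + 1)
        * ((z + 1) / (z - 1)) powr (\<alpha> / 2) * Legendre_Q \<gamma> \<alpha> z"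
      unfolding J1[OF opposite] Q powr prefactor_b half
      by (rule arg_cong2[where f = "(*)"], simp add: add_ac mult_ac,
          rule arg_cong[where f = exp], simp add: field_simps)
  next
    have deg: "2 * (\<gamma> + 1) - (- \<alpha> + \<gamma> + 1) = \<gamma> + \<alpha> + 1"
      by simp
    show "Jacobi_Q \<gamma> (- \<alpha>) \<alpha> z = exp (- \<i> * of_real pi * \<alpha>) * Gamma (\<gamma> - \<alpha> + 1) * rGamma (\<gamma> + 1)
        * ((z - 1) / (z + 1)) powr (\<alpha> / 2) * Legendre_Q \<gamma> \<alpha> z"
      unfolding J2[OF opposite[of "- \<alpha>", unfolded minus_minus]] Q powr prefactor_b half deg
      by (rule arg_cong2[where f = "(*)"], simp add: add_ac mult_ac,
          rule arg_cong[where f = exp], simp add: field_simps)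
  qed
qed

end
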